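(* Let $s$ and $n$ be positive integers and let $A=(a_{ij})_{1\le i\le s+n-1,\ 1\le j\le sn}$ be an $(s+n-1)\times sn$ matrix. Put $$\mathcal{R}=\binom{[s+n-1]}{n},\qquad \mathcal{C}=\{\iota_{s,n}(\mu)\mid \mu\in Z_{s,n}\},\qquad \mathcal{C}^{0}=\{\iota_{s,n}(\mu)\mid \mu\in Z^0_{s,s+n-1}\}.$$ Then $$\det\left(\det A^{I}_{J}\right)_{I\in\mathcal{R},\ J\in\mathcal{C}}=\prod_{J\in\mathcal{C}^{0}}\det A_{J},$$ where the rows and the columns of the matrix on the left-hand side are arranged in increasing order with respect to the lexicographic order $<$ on $n$-element subsets.
   Context: Notation. The matrix $A$ has entries in a commutative ring (for example, indeterminates). $[r,t]=\{r,r+1,\dots,t\}$, which is empty if $r>t$, and $[r]=[1,r]$. $\binom{S}{r}$ is the set of $r$-element subsets of a finite set $S$. For $I=\{i_1<\cdots<i_r\}$ and $J=\{j_1<\cdots<j_r\}$ in $\binom{[N]}{r}$, write $I<J$ if there is an index $k$ with $i_1=j_1,\dots,i_{k-1}=j_{k-1}$ and $i_k<j_k$ (lexicographic order). For positive integers $s,m$: $Z_{s,m}=\{\mu=(\mu_1,\dots,\mu_s)\in\mathbb{Z}^s\mid \mu_i\ge 0 \text{ for all } i,\ \mu_1+\cdots+\mu_s=m\}$ and $Z^0_{s,m}=\{\mu\in\mathbb{Z}^s\mid \mu_i>0\text{ for all }i,\ \mu_1+\cdots+\mu_s=m\}$. For an integer sequence $\mu=(\mu_1,\dots,\mu_s)$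 with $0\le\mu_i\le n$ for all $i$, put $\iota_{s,n}(\mu)=\bigsqcup_{i=1}^{s}[(i-1)n+1,(i-1)n+\mu_i]\subseteq[sn]$. (Elements of $Z^0_{s,s+n-1}$ satisfy $1\le\mu_i\le n$, so $\iota_{s,n}$ is defined on them and yields $(s+n-1)$-element subsets of $[sn]$.) For a row index set $I=\{i_1<\cdots<i_r\}$ and a column index set $J=\{j_1<\cdots<j_r\}$, $A^I_J=(a_{i_p,j_q})_{1\le p,q\le r}$ is the corresponding submatrix. $A_J$ denotes the submatrix with all rows of $A$ and the columns indexed by $J$. *)

theory Defs
  imports
    "Jordan_Normal_Form.Determinant"
    "Jordan_Normal_Form.DL_Submatrix"
begin

(* Index sets are 0-based, as is customary for matrices in this library: the set
   {1,...,N} is rendered as {0..<N}.  The shift preserves all orders.  The (k+1)-st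
   smallest element of an index set I is pick I k, and submatrix A I J keeps the rows
   in I and the columns in J, each in increasing order. *)

(* Lexicographic order; only used to compare finite sets of the same cardinality. *)
definition lex_less :: "nat set \<Rightarrow> nat set \<Rightarrow> bool" where
  "lex_less I J \<longleftrightarrow> (\<exists>k < min (card I) (card J).
     (\<forall>l < k. pick I l = pick J l) \<and> pick I k < pick J k)"

(* The lexicographically increasing enumeration of a finite family of r-element sets;
   it is well defined by lex_list_ex1 below. *)
definition lex_list :: "nat set set \<Rightarrow> nat set list" where
  "lex_list F = (THE xs. sorted_wrt lex_less xs \<and> set xs = F)"

(* Nonnegativity of the parts is built into the type nat. *)
definition Zs :: "nat \<Rightarrow> nat \<Rightarrow> nat list set" where
  "Zs s m = {\<mu>. length \<mu> = s \<and> sum_list \<mu> = m}"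

definition Zs0 :: "nat \<Rightarrow> nat \<Rightarrow> nat list set" where
  "Zs0 s m = {\<mu>. length \<mu> = s \<and> (\<forall>i < s. 0 < \<mu> ! i) \<and> sum_list \<mu> = m}"

(* For 0 <= \<mu>_i <= n, the interval [(i-1)n+1, (i-1)n+\<mu>_i] of 1-based column indices becomes
   {i*n ..< i*n + \<mu> ! i} after shifting both i and the columns to start at 0. *)
definition iota :: "nat \<Rightarrow> nat \<Rightarrow> nat list \<Rightarrow> nat set" where
  "iota s n \<mu> = (\<Union>i < s. {i * n ..< i * n + \<mu> ! i})"

definition row_sets :: "nat \<Rightarrow> nat \<Rightarrow> nat set set" where
  "row_sets s n = {I. I \<subseteq> {0..<s + n - 1} \<and> card I = n}"

definition col_sets :: "nat \<Rightarrow> nat \<Rightarrow> nat set set" where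
  "col_sets s n = iota s n ` Zs s n"

definition col_sets0 :: "nat \<Rightarrow> nat \<Rightarrow> nat set set" where
  "col_sets0 s n = iota s n ` Zs0 s (s + n - 1)"

(* The matrix (det A^I_J) for I in R and J in C.  The two dimensions are the cardinalities
   of R and C; recall that det is 0 for a matrix that is not square. *)
definition minor_mat :: "'a::comm_ring_1 mat \<Rightarrow> nat set set \<Rightarrow> nat set set \<Rightarrow> 'a mat" where
  "minor_mat A R C = mat (length (lex_list R)) (length (lex_list C))
     (\<lambda>(p, q). det (submatrix A (lex_list R ! p) (lex_list C ! q)))"

lemma pick_image:
  assumes "finite I"
  shows "pick I ` {..<card I} = I"
proof
  show "pick I ` {..<card I} \<subseteq> I"
    using pick_in_set_le by auto
  show "I \<subseteq> pick I ` {..<card I}"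
  proof
    fix i assume i: "i \<in> I"
    then have "{a \<in> I. a < i} \<subset> I" by auto
    then have "card {a \<in> I. a < i} < card I"
      using assms by (simp add: psubset_card_mono)
    then show "i \<in> pick I ` {..<card I}"
      by (intro image_eqI[where x = "card {a \<in> I. a < i}"]) (simp_all add: pick_card_in_set[OF i])
  qed
qed

lemma lex_less_irrefl: "\<not> lex_less I I"
  by (auto simp: lex_less_def)

lemma lex_less_trans:
  assumes "lex_less I J" "lex_less J K" "card I = card J" "card J = card K"
  shows "lex_less I K"
proof -
  obtain k where k: "k < card J" "\<forall>l<k. pick I l = pick J l" "pick I k < pick J k"
    using assms by (auto simp: lex_less_def)
  obtain m where m: "m < card J" "\<forall>l<m. pick J l = pick K l" "pick J m < pick K m"
    using assms by (auto simp: lex_less_def)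
  have "pick I (min k m) < pick K (min k m)"
    using k m by (cases k m rule: linorder_cases) (auto simp: min_def)
  moreover have "\<forall>l < min k m. pick I l = pick K l"
    using k m by auto
  moreover have "min k m < min (card I) (card K)"
    using k(1) assms by auto
  ultimately show ?thesis
    unfolding lex_less_def by blast
qed

lemma lex_less_total:
  assumes "finite I" "finite J" "card I = card J" "I \<noteq> J"
  shows "lex_less I J \<or> lex_less J I"
proof -
  let ?P = "\<lambda>k. k < card I \<and> pick I k \<noteq> pick J k"
  have "\<exists>k. ?P k"
  proof (rule ccontr)
    assume "\<nexists>k. ?P k"
    then have "pick I ` {..<card I} = pick J ` {..<card J}"
      using assms(3) by auto
    then show False
      using pick_image[OF assms(1)] pick_image[OF assms(2)] assms(4) by simp
  qed
  then obtain k where k: "k < card I" "pick I k \<noteq> pick J k"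
    and l: "\<And>l. l < k \<Longrightarrow> \<not> ?P l"
    using exists_least_iff[of ?P] by blast
  have eq: "\<forall>l < k. pick I l = pick J l"
    using k(1) l by (meson less_trans)
  consider "pick I k < pick J k" | "pick J k < pick I k"
    using k(2) by (rule linorder_neqE_nat)
  then show ?thesis
  proof cases
    case 1
    then have "lex_less I J"
      unfolding lex_less_def using k(1) eq assms(3) by (intro exI[of _ k]) simp
    then show ?thesis ..
  next
    case 2
    then have "lex_less J I"
      unfolding lex_less_def using k(1) eq assms(3) by (intro exI[of _ k]) simp
    then show ?thesis ..
  qed
qed

lemma lex_list_ex1:
  assumes "finite F" "\<And>I. I \<in> F \<Longrightarrow> finite I \<and> card I = r"
  shows "\<exists>!xs. sorted_wrt lex_less xs \<and> set xs = F"
  using assms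
proof (induction "card F" arbitrary: F)
  case 0
  then show ?case by auto
next
  case (Suc c)
  have asym: "\<not> lex_less J I" if "lex_less I J" "I \<in> F" "J \<in> F" for I J
    using lex_less_trans[of I J I] lex_less_irrefl[of I] that Suc.prems(2) by auto
  have "F \<noteq> {}" using Suc.hyps(2) by auto
  moreover have "asymp_on F lex_less"
    using asym by (auto simp: asymp_on_def)
  moreover have "transp_on F lex_less"
    by (rule transp_onI) (rule lex_less_trans, use Suc.prems(2) in auto)
  ultimately obtain m where m: "m \<in> F" "\<forall>I\<in>F. I \<noteq> m \<longrightarrow> \<not> lex_less I m"
    using Finite_Set.bex_min_element[OF Suc.prems(1)] by blast
  have min: "\<forall>I\<in>F - {m}. lex_less m I"
  proof
    fix I assume I: "I \<in> F - {m}"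
    then have "lex_less m I \<or> lex_less I m"
      using m(1) Suc.prems(2) by (intro lex_less_total) auto
    then show "lex_less m I"
      using I m(2) by blast
  qed
  have "c = card (F - {m})"
    using m Suc.hyps(2) Suc.prems(1) by simp
  then have ex1: "\<exists>!xs. sorted_wrt lex_less xs \<and> set xs = F - {m}"
    using Suc.hyps(1)[of "F - {m}"] Suc.prems by auto
  then obtain xs where xs: "sorted_wrt lex_less xs" "set xs = F - {m}"
    by blast
  show ?case
  proof (rule ex1I[of _ "m # xs"])
    show "sorted_wrt lex_less (m # xs) \<and> set (m # xs) = F"
      using xs min m by auto
    fix ys assume ys: "sorted_wrt lex_less ys \<and> set ys = F"
    with m obtain y zs where y: "ys = y # zs" by (cases ys) auto
    have "y = m"
      using ys y m by auto
    moreover have "m \<notin> set zs"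
      using ys y \<open>y = m\<close> lex_less_irrefl by auto
    ultimately have "set zs = F - {m}" "sorted_wrt lex_less zs"
      using ys y by auto
    then show "ys = m # xs"
      using ex1 xs y \<open>y = m\<close> by blast
  qed
qed

lemma lex_list:
  assumes "finite F" "\<And>I. I \<in> F \<Longrightarrow> finite I \<and> card I = r"
  shows "sorted_wrt lex_less (lex_list F)" "set (lex_list F) = F"
proof -
  have "sorted_wrt lex_less (lex_list F) \<and> set (lex_list F) = F"
    unfolding lex_list_def by (rule theI'[OF lex_list_ex1[where r = r]]) (use assms in auto)
  then show "sorted_wrt lex_less (lex_list F)" "set (lex_list F) = F"
    by simp_all
qed

lemma card_iota:
  assumes "length \<mu> = s" "\<And>i. i < s \<Longrightarrow> \<mu> ! i \<le> n"
  shows "card (iota s n \<mu>) = sum_list \<mu>"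
proof -
  have "disjoint_family_on (\<lambda>i. {i * n ..< i * n + \<mu> ! i}) {..<s}"
  proof -
    have "{i * n ..< i * n + \<mu> ! i} \<inter> {j * n ..< j * n + \<mu> ! j} = {}"
      if "i < j" "j < s" for i j
    proof -
      have "Suc i * n \<le> j * n" using that by (intro mult_le_mono1) simp
      moreover have "\<mu> ! i \<le> n" using that assms(2) by simp
      ultimately show ?thesis by auto
    qed
    then show ?thesis
      unfolding disjoint_family_on_def by (metis Int_commute lessThan_iff nat_neq_iff)
  qed
  then have "card (iota s n \<mu>) = (\<Sum>i<s. card {i * n ..< i * n + \<mu> ! i})"
    unfolding iota_def by (intro card_UN_disjoint) (auto simp: disjoint_family_on_def)
  also have "\<dots> = sum_list \<mu>"
    using assms(1) by (simp add: sum_list_sum_nth atLeast0LessThan)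
  finally show ?thesis .
qed

lemma lex_list_row_sets:
  shows "sorted_wrt lex_less (lex_list (row_sets s n))"
    "set (lex_list (row_sets s n)) = row_sets s n"
proof -
  have "finite (row_sets s n)"
    by (rule finite_subset[of _ "Pow {0..<s + n - 1}"]) (auto simp: row_sets_def)
  moreover have "finite I \<and> card I = n" if "I \<in> row_sets s n" for I
    using that by (auto simp: row_sets_def intro: finite_subset)
  ultimately show "sorted_wrt lex_less (lex_list (row_sets s n))"
    "set (lex_list (row_sets s n)) = row_sets s n"
    by (rule lex_list[where r = n]; simp)+
qed

lemma lex_list_col_sets:
  shows "sorted_wrt lex_less (lex_list (col_sets s n))"
    "set (lex_list (col_sets s n)) = col_sets s n"
proof -
  have le: "\<mu> ! i \<le> n" if "\<mu> \<in> Zs s n" "i < s" for \<mu> i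
    using that elem_le_sum_list[of i \<mu>] by (auto simp: Zs_def)
  have "Zs s n \<subseteq> {\<mu>. set \<mu> \<subseteq> {..n} \<and> length \<mu> = s}"
    using le by (auto simp: Zs_def in_set_conv_nth)
  then have "finite (Zs s n)"
    by (rule finite_subset) (rule finite_lists_length_eq, simp)
  then have "finite (col_sets s n)"
    by (simp add: col_sets_def)
  moreover have "finite J \<and> card J = n" if "J \<in> col_sets s n" for J
  proof -
    obtain \<mu> where \<mu>: "\<mu> \<in> Zs s n" "J = iota s n \<mu>"
      using \<open>J \<in> col_sets s n\<close> by (auto simp: col_sets_def)
    then have "card J = n"
      using card_iota[of \<mu> s n] le by (auto simp: Zs_def)
    moreover have "finite J"
      using \<mu> by (auto simp: iota_def)
    ultimately show ?thesis by blast
  qed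
  ultimately show "sorted_wrt lex_less (lex_list (col_sets s n))"
    "set (lex_list (col_sets s n)) = col_sets s n"
    by (rule lex_list[where r = n]; simp)+
qed

end

theory Submission
  imports
    Defs
    "HOL-Library.Sublist"
    "HOL-Library.Poly_Mapping"
    "HOL-Library.Nat_Bijection"
    "HOL-Computational_Algebra.Fraction_Field"
begin

text \<open>Induction on \<open>s + n\<close>. The columns are split into \<open>s\<close> ordered blocks; let \<open>v\<close> be the first column of
  the first block. Row operations turn \<open>v\<close> into a multiple \<open>p\<close> of the first unit vector, and they change
  neither side. Then a minor with column \<open>v\<close> but without the first row vanishes, so in lexicographic
  order the compound matrix is block triangular. Up to powers of \<open>p\<close>, its diagonal blocks are the
  compound matrices for \<open>(s, n - 1)\<close> (delete \<open>v\<close> from its block) and for \<open>(s - 1, n)\<close> (delete the whole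
  first block), both with the first row removed. The right-hand side factors in the same way,
  according to whether the first part of \<open>\<mu>\<close> is at least 2 or equal to 1.
  The elimination needs a field; the fraction field of a polynomial ring gives the identity for
  the generic matrix, hence over every commutative ring.\<close>

subsection \<open>Minors and row operations\<close>

text \<open>Index lists instead of sets allow recursion on the first index as well as repeated rows.
  Lists of different lengths give 0, because \<open>det\<close> vanishes on non-square
  matrices.\<close>

definition minor :: "('r \<Rightarrow> 'c \<Rightarrow> 'a::comm_ring_1) \<Rightarrow> 'r list \<Rightarrow> 'c list \<Rightarrow> 'a" where
  "minor a I J = det (mat (length I) (length J) (\<lambda>(p, q). a (I ! p) (J ! q)))"

definition minors :: "('r \<Rightarrow> 'c \<Rightarrow> 'a::comm_ring_1) \<Rightarrow> 'r list list \<Rightarrow> 'c list list \<Rightarrow> 'a mat" where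
  "minors a R C = mat (length R) (length C) (\<lambda>(p, q). minor a (R ! p) (C ! q))"

lemma minor_Nil [simp]: "minor a [] [] = 1"
  by (simp add: minor_def)

lemma minor_eq_0_if_length_neq: "length I \<noteq> length J \<Longrightarrow> minor a I J = 0"
  by (simp add: minor_def det_def)

lemma minor_eq_0_if_not_distinct:
  assumes "\<not> distinct I"
  shows "minor a I J = 0"
proof (cases "length I = length J")
  case True
  obtain p q where pq: "p < length I" "q < length I" "p \<noteq> q" "I ! p = I ! q"
    using assms by (auto simp: distinct_conv_nth)
  show ?thesis
    unfolding minor_def
    by (rule det_identical_rows[OF _ pq(3,1,2)]) (use pq True in \<open>auto simp: row_def\<close>)
qed (rule minor_eq_0_if_length_neq)

text \<open>Laplace expansion along row \<open>p\<close>, whose cofactors do not depend on the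
  entries of that row.\<close>

lemma det_row_linear:
  fixes u v :: "nat \<Rightarrow> 'a::comm_ring_1"
  assumes "p < n"
  shows "det (mat n n (\<lambda>(i, j). if i = p then u j + c * v j else w i j)) =
    det (mat n n (\<lambda>(i, j). if i = p then u j else w i j)) +
    c * det (mat n n (\<lambda>(i, j). if i = p then v j else w i j))"
proof -
  define M where "M u = mat n n (\<lambda>(i, j). if i = p then u j else w i j)" for u :: "nat \<Rightarrow> 'a"
  have M: "M u \<in> carrier_mat n n" for u
    by (simp add: M_def)
  have cof: "cofactor (M u) p j = cofactor (M (\<lambda>_. 0)) p j" for u j
  proof -
    have "mat_delete (M u) p j = mat_delete (M (\<lambda>_. 0)) p j"
      by (rule eq_matI) (auto simp: mat_delete_def M_def)
    then show ?thesis
      by (simp add: cofactor_def)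
  qed
  have "det (M u) = (\<Sum>j<n. u j * cofactor (M (\<lambda>_. 0)) p j)" for u
    using laplace_expansion_row[OF M assms, of u] assms
    unfolding cof[of u] by (simp add: M_def[of u])
  then have "det (M (\<lambda>j. u j + c * v j)) = det (M u) + c * det (M v)"
    by (simp add: sum.distrib algebra_simps sum_distrib_left)
  then show ?thesis
    by (simp add: M_def)
qed

text \<open>None of the rows that are added is itself modified, so this is a succession of
  elementary row operations.\<close>

lemma det_add_rows:
  fixes M :: "'a::comm_ring_1 mat"
  assumes M: "M \<in> carrier_mat n n" and S: "S \<subseteq> {..<n}" and g: "g ` S \<subseteq> {..<n} - S"
  shows "det (mat n n (\<lambda>(p, q). M $$ (p, q) + (if p \<in> S then c * M $$ (g p, q) else 0))) = det M"
proof -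
  define N where
    "N T = mat n n (\<lambda>(p, q). M $$ (p, q) + (if p \<in> T then c * M $$ (g p, q) else 0))" for T
  have "finite T \<Longrightarrow> T \<subseteq> S \<Longrightarrow> det (N T) = det M" for T
  proof (induction T rule: finite_induct)
    case empty
    have "N {} = M"
      using M by (intro eq_matI) (auto simp: N_def)
    then show ?case by simp
  next
    case (insert p T)
    have p: "p \<in> S" "p \<notin> T" "p < n" "g p < n" "g p \<notin> S" "g p \<noteq> p" "g p \<notin> T"
      using insert S g by auto
    have "N (insert p T) = addrow c p (g p) (N T)"
      by (rule eq_matI) (use p in \<open>auto simp: N_def\<close>)
    then show ?case
      using det_addrow[of "g p" n p "N T" c] p insert by (auto simp: N_def)
  qed
  from this[of S] show ?thesis
    using S finite_subset by (auto simp: N_def)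
qed

definition add_row :: "'a \<Rightarrow> 'r \<Rightarrow> 'r \<Rightarrow> ('r \<Rightarrow> 'c \<Rightarrow> 'a::comm_ring_1) \<Rightarrow> 'r \<Rightarrow> 'c \<Rightarrow> 'a" where
  "add_row c k l a i j = (if i = l then a l j + c * a k j else a i j)"

lemma minor_add_row_notin:
  assumes "l \<notin> set I"
  shows "minor (add_row c k l a) I J = minor a I J"
proof -
  have "I ! p \<noteq> l" if "p < length I" for p
    using that assms by auto
  then show ?thesis
    unfolding minor_def by (intro arg_cong[where f = det] eq_matI) (auto simp: add_row_def)
qed

text \<open>Linearity in the row \<open>l\<close>. Replacing \<open>l\<close> by \<open>k\<close> in
  place causes no sign, but the new list repeats \<open>k\<close> if \<open>k\<close> already occurs
  in \<open>I\<close>.\<close>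

lemma minor_add_row_in:
  assumes "distinct I" "l \<in> set I"
  shows "minor (add_row c k l a) I J =
    minor a I J + c * minor a (map (\<lambda>i. if i = l then k else i) I) J"
proof (cases "length I = length J")
  case True
  obtain p where p: "p < length I" "I ! p = l"
    using assms(2) by (auto simp: in_set_conv_nth)
  have nth: "I ! i = l \<longleftrightarrow> i = p" if "i < length I" for i
    using p assms(1) that nth_eq_iff_index_eq by blast
  show ?thesis
    using det_row_linear[OF p(1), of "\<lambda>q. a l (J ! q)" c "\<lambda>q. a k (J ! q)" "\<lambda>p q. a (I ! p) (J ! q)"]
    unfolding minor_def True[symmetric] length_map
    by (smt (verit, best) cong_mat nth p case_prod_conv add_row_def nth_map)
qed (simp add: minor_eq_0_if_length_neq)

section \<open>Sublists of a fixed length\<close>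

definition ksubseqs :: "nat \<Rightarrow> 'a list \<Rightarrow> 'a list list" where
  "ksubseqs n xs = filter (\<lambda>ys. length ys = n) (subseqs xs)"

lemma set_ksubseqs: "set (ksubseqs n xs) = {ys. subseq ys xs \<and> length ys = n}"
  by (auto simp: ksubseqs_def)

lemma ksubseqs_Nil: "ksubseqs (Suc n) [] = []"
  by (simp add: ksubseqs_def)

text \<open>Pascal's recursion, with the sublists through the head coming first; for increasing
  lists this makes the enumeration lexicographic.\<close>

lemma ksubseqs_Cons:
  "ksubseqs (Suc n) (x # xs) = map (Cons x) (ksubseqs n xs) @ ksubseqs (Suc n) xs"
  by (simp add: ksubseqs_def Let_def filter_map comp_def)

lemma ksubseqs_0 [simp]: "ksubseqs 0 xs = [[]]"
  by (induction xs) (simp_all add: ksubseqs_def Let_def filter_map comp_def)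

lemma length_ksubseqs: "length (ksubseqs n xs) = length xs choose n"
proof (induction xs arbitrary: n)
  case Nil
  then show ?case by (cases n) (simp_all add: ksubseqs_Nil)
next
  case (Cons x xs)
  then show ?case by (cases n) (simp_all add: ksubseqs_Cons)
qed

lemma ksubseqs_length_self: "ksubseqs (length xs) xs = [xs]"
proof -
  have "ys = xs" if "subseq ys xs" "length ys = length xs" for ys :: "'a list"
    using that by (simp add: subseq_same_length)
  then have "set (ksubseqs (length xs) xs) \<subseteq> {xs}"
    by (auto simp: set_ksubseqs)
  moreover have "length (ksubseqs (length xs) xs) = 1"
    by (simp add: length_ksubseqs)
  ultimately show ?thesis
    by (cases "ksubseqs (length xs) xs") auto
qed

lemma subseq_distinct_eq_filter:
  assumes "subseq ys xs" "distinct xs"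
  shows "ys = filter (\<lambda>x. x \<in> set ys) xs"
  using assms
proof (induction rule: list_emb.induct)
  case (list_emb_Cons xs ys y)
  then have "y \<notin> set xs"
    using subseqs_powset[of ys] by auto
  then show ?case
    using list_emb_Cons by simp
next
  case (list_emb_Cons2 x y xs ys)
  then have "filter (\<lambda>z. z \<in> set (x # xs)) ys = filter (\<lambda>z. z \<in> set xs) ys"
    by (intro filter_cong) auto
  then show ?case
    using list_emb_Cons2 by simp
qed simp

text \<open>Because the two rows are adjacent, exchanging one for the other keeps the row list
  increasing, so no signs arise.\<close>

lemma subseq_replace_adjacent:
  assumes I: "subseq I (xs @ [u, v] @ ys)" and d: "distinct (xs @ [u, v] @ ys)"
    and kl: "{k, l} = {u, v}" and l: "l \<in> set I" and k: "k \<notin> set I"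
  shows "subseq (map (\<lambda>i. if i = l then k else i) I) (xs @ [u, v] @ ys)"
proof -
  let ?f = "\<lambda>i. if i = l then k else i"
  have uv: "(k = u \<and> l = v) \<or> (k = v \<and> l = u)"
    using kl by (auto simp: doubleton_eq_iff)
  have map_id: "map ?f (filter P zs) = filter P zs" if "l \<notin> set zs" for P zs
    using that by (intro map_idI) auto
  have "map ?f I = filter (\<lambda>x. x \<in> set I) xs @ [k] @ filter (\<lambda>x. x \<in> set I) ys"
    using uv d l k map_id[of xs] map_id[of ys]
    by (subst subseq_distinct_eq_filter[OF I d]) (elim disjE; simp)
  moreover have "subseq [k] [u, v]"
    using uv by auto
  ultimately show ?thesis
    by (metis list_emb_append_mono subseq_filter_left)
qed

text \<open>A row operation on \<open>a\<close> induces row operations on the matrix of minors: if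
  \<open>I\<close> contains \<open>l\<close> but not \<open>k\<close>, its row gains
  \<open>c\<close> times the row of \<open>I\<close> with \<open>l\<close> exchanged for
  \<open>k\<close>; all other rows stay fixed.\<close>

lemma det_minors_add_row:
  assumes xs: "xs = ys @ [u, v] @ zs" "distinct xs" and kl: "{k, l} = {u, v}"
    and C: "length C = length (ksubseqs n xs)"
  shows "det (minors (add_row c k l a) (ksubseqs n xs) C) = det (minors a (ksubseqs n xs) C)"
proof -
  define R where "R = ksubseqs n xs"
  define f where "f = map (\<lambda>i. if i = l then k else i)"
  define S where "S = {p. p < length R \<and> l \<in> set (R ! p) \<and> k \<notin> set (R ! p)}"
  have kl_neq: "k \<noteq> l"
    using kl xs by (auto simp: doubleton_eq_iff)
  have R: "subseq (R ! p) xs" "length (R ! p) = n" "distinct (R ! p)" if "p < length R" for p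
    using that nth_mem[OF that] xs(2) subseqs_distinctD[of "R ! p" xs]
    by (auto simp: R_def set_ksubseqs)
  have "\<exists>r<length R. R ! r = f (R ! p)" if "p \<in> S" for p
  proof -
    have "f (R ! p) \<in> set R"
      using that subseq_replace_adjacent[of "R ! p" ys u v zs k l] R[of p] xs kl
      by (auto simp: R_def set_ksubseqs S_def f_def)
    then show ?thesis
      by (metis in_set_conv_nth)
  qed
  then obtain g where g: "g p < length R" "R ! g p = f (R ! p)" if "p \<in> S" for p
    by metis
  \<comment> \<open>The exchanged list no longer contains \<open>l\<close>, so the rows that are
    added lie outside \<open>S\<close>, as \<open>det_add_rows\<close> demands.\<close>
  have gS: "g ` S \<subseteq> {..<length R} - S"
    using g by (force simp: S_def f_def)
  have "minors (add_row c k l a) R C = mat (length R) (length R)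
    (\<lambda>(p, q). minors a R C $$ (p, q) + (if p \<in> S then c * minors a R C $$ (g p, q) else 0))"
    (is "_ = ?M")
  proof (rule eq_matI)
    fix p q assume "p < dim_row ?M" "q < dim_col ?M"
    then have pq: "p < length R" "q < length R" by auto
    have "minor (add_row c k l a) (R ! p) (C ! q) =
      minor a (R ! p) (C ! q) + (if p \<in> S then c * minor a (f (R ! p)) (C ! q) else 0)"
    proof (cases "l \<in> set (R ! p)")
      case True
      show ?thesis
      proof (cases "p \<in> S")
        \<comment> \<open>With both \<open>k\<close> and \<open>l\<close> present, the exchange
          repeats \<open>k\<close> and the additional minor vanishes.\<close>
        case False
        with True pq have "k \<in> set (R ! p)"
          by (simp add: S_def)
        then obtain i j where ij: "i < length (R ! p)" "R ! p ! i = k" "j < length (R ! p)" "R ! p ! j = l"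
          using True by (metis in_set_conv_nth)
        then have "f (R ! p) ! i = f (R ! p) ! j" "i \<noteq> j" "i < length (f (R ! p))" "j < length (f (R ! p))"
          using kl_neq by (auto simp: f_def)
        then have "\<not> distinct (f (R ! p))"
          by (metis nth_eq_iff_index_eq)
        then show ?thesis
          using False True R(3)[OF pq(1)] minor_add_row_in[of "R ! p" l c k a "C ! q"]
          by (simp add: minor_eq_0_if_not_distinct f_def)
      qed (use True R(3)[OF pq(1)] minor_add_row_in[of "R ! p" l c k a "C ! q"] in \<open>simp add: f_def\<close>)
    qed (simp add: S_def minor_add_row_notin)
    then show "minors (add_row c k l a) R C $$ (p, q) = ?M $$ (p, q)"
      using pq C g by (simp add: minors_def R_def)
  qed (use C in \<open>auto simp: minors_def R_def\<close>)
  also have "det ?M = det (minors a R C)"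
    by (rule det_add_rows[OF _ _ gS]) (use C in \<open>auto simp: minors_def R_def S_def\<close>)
  finally show ?thesis
    by (simp add: R_def)
qed

text \<open>Treats a maximal minor as the 1 by 1 case of \<open>minors\<close>, so that one
  invariance statement serves both sides of the identity.\<close>

lemma minor_eq_det_minors:
  "length J = length xs \<Longrightarrow> minor a xs J = det (minors a (ksubseqs (length xs) xs) [J])"
  by (simp add: ksubseqs_length_self minors_def det_single)

text \<open>Elimination from the bottom up, by operations between adjacent rows only, since these
  are the ones covered by \<open>det_minors_add_row\<close>. The rows \<open>ys\<close> above the
  pivot row are carried along so that the induction can move the pivot down.\<close>

lemma ex_cleared_column:
  fixes a :: "'r \<Rightarrow> 'c \<Rightarrow> 'a::field"
  assumes "distinct (ys @ x # xs)"
  shows "\<exists>b. (\<forall>y\<in>set xs. b y v = 0) \<and>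
    (\<forall>n C. length C = length (ksubseqs n (ys @ x # xs)) \<longrightarrow>
      det (minors b (ksubseqs n (ys @ x # xs)) C) = det (minors a (ksubseqs n (ys @ x # xs)) C))"
  using assms
proof (induction xs arbitrary: ys x)
  case Nil
  then show ?case by auto
next
  case (Cons y zs)
  let ?xs = "ys @ x # y # zs"
  obtain b where b0: "\<And>z. z \<in> set zs \<Longrightarrow> b z v = 0"
    and b: "\<And>n C. length C = length (ksubseqs n ?xs) \<Longrightarrow>
      det (minors b (ksubseqs n ?xs) C) = det (minors a (ksubseqs n ?xs) C)"
    using Cons.IH[of "ys @ [x]" y] Cons.prems by auto
  \<comment> \<open>If the pivot vanishes, adding row \<open>y\<close> to row \<open>x\<close> makes
    the two entries in column \<open>v\<close> equal. A zero pivot in \<open>b'\<close> therefore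
    forces \<open>b' y v = 0\<close>, and the division by zero in \<open>b''\<close> is
    harmless.\<close>
  define b' where "b' = (if b x v = 0 then add_row 1 y x b else b)"
  define b'' where "b'' = add_row (- (b' y v / b' x v)) x y b'"
  have neq: "x \<noteq> y" "x \<notin> set zs" "y \<notin> set zs"
    using Cons.prems by auto
  have "det (minors b' (ksubseqs n ?xs) C) = det (minors a (ksubseqs n ?xs) C)"
    if "length C = length (ksubseqs n ?xs)" for n C
    using det_minors_add_row[of ?xs ys x y zs y x C n 1 b] that Cons.prems b
    by (auto simp: b'_def insert_commute)
  then have "det (minors b'' (ksubseqs n ?xs) C) = det (minors a (ksubseqs n ?xs) C)"
    if "length C = length (ksubseqs n ?xs)" for n C
    using det_minors_add_row[of ?xs ys x y zs x y C n _ b'] that Cons.prems by (simp add: b''_def)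
  moreover have "b'' z v = 0" if "z \<in> set (y # zs)" for z
    using that neq b0 by (auto simp: b''_def b'_def add_row_def)
  ultimately show ?case
    by blast
qed

subsection \<open>The identity over a field\<close>

text \<open>Each list in the second argument is the ordered column list of one block; a selection takes
  an initial segment of every block.\<close>

fun prefix_choices :: "nat \<Rightarrow> 'a list list \<Rightarrow> 'a list list" where
  "prefix_choices 0 fs = [[]]"
| "prefix_choices (Suc n) [] = []"
| "prefix_choices (Suc n) ([] # fs) = prefix_choices (Suc n) fs"
| "prefix_choices (Suc n) ((v # f) # fs) =
    map (Cons v) (prefix_choices n (f # fs)) @ prefix_choices (Suc n) fs"

text \<open>Here the total size is \<^term>\<open>length fs + n - 1\<close> and every initial segment is nonempty.\<close>

fun full_choices :: "nat \<Rightarrow> 'a list list \<Rightarrow> 'a list list" where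
  "full_choices n [] = (if n = 1 then [[]] else [])"
| "full_choices 0 (f # fs) = []"
| "full_choices (Suc n) ([] # fs) = []"
| "full_choices (Suc n) ((v # f) # fs) =
    map (Cons v) (full_choices (Suc n) fs @ full_choices n (f # fs))"

text \<open>Together with \<open>length_ksubseqs\<close> this makes the matrix of minors square. The
  recursion is Pascal's rule; the length bound keeps blocks from running out.\<close>

lemma length_prefix_choices:
  "\<forall>f\<in>set fs. n \<le> length f \<Longrightarrow> length (prefix_choices n fs) = (length fs + n - 1) choose n"
proof (induction n fs rule: prefix_choices.induct)
  case (4 n v f fs)
  then have "\<forall>g\<in>set (f # fs). n \<le> length g"
    by (auto intro: Suc_leD)
  then show ?case
    using 4 by simp
qed auto

text \<open>The count gives the exponent of the pivot on the right-hand side.\<close>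

lemma length_full_choices:
  "\<forall>f\<in>set fs. n \<le> length f \<Longrightarrow> n > 0 \<Longrightarrow>
    length (full_choices n fs) = (length fs + n - 2) choose (n - 1)"
proof (induction n fs rule: full_choices.induct)
  case (4 n v f fs)
  then have "\<forall>g\<in>set (f # fs). n \<le> length g"
    by (auto intro: Suc_leD)
  then show ?case
    using 4 by (cases n; cases fs) auto
qed (auto simp: binomial_eq_0)

lemma full_choices_length_eq: "J \<in> set (full_choices n fs) \<Longrightarrow> Suc (length J) = length fs + n"
  by (induction n fs arbitrary: J rule: full_choices.induct) (auto split: if_splits)

lemma minor_Cons_Cons:
  fixes a :: "'r \<Rightarrow> 'c \<Rightarrow> 'a::comm_ring_1"
  assumes "\<And>y. y \<in> set I \<Longrightarrow> a y v = 0"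
  shows "minor a (x # I) (v # J) = a x v * minor a I J"
proof (cases "length I = length J")
  case True
  let ?n = "length I"
  have "mat (Suc ?n) (Suc ?n) (\<lambda>(p, q). a ((x # I) ! p) ((v # J) ! q)) =
    four_block_mat (mat 1 1 (\<lambda>_. a x v)) (mat 1 ?n (\<lambda>(p, q). a x (J ! q))) (0\<^sub>m ?n 1)
      (mat ?n ?n (\<lambda>(p, q). a (I ! p) (J ! q)))"
    using assms by (intro eq_matI) (auto simp: nth_Cons')
  then show ?thesis
    using True
    by (simp add: minor_def det_four_block_mat_lower_left_zero_col[of _ _ ?n] det_single)
qed (simp add: minor_eq_0_if_length_neq)

text \<open>The lower left block vanishes because its minors have a zero column; each entry of the
  upper left block carries a factor \<open>a x v\<close>, which comes out once per column.\<close>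

lemma det_minors_block:
  fixes a :: "'r \<Rightarrow> 'c \<Rightarrow> 'a::idom"
  assumes a: "\<And>y. y \<in> set xs \<Longrightarrow> a y v = 0"
    and R1: "\<And>I. I \<in> set R1 \<Longrightarrow> set I \<subseteq> set xs" and R2: "\<And>I. I \<in> set R2 \<Longrightarrow> set I \<subseteq> set xs"
    and len: "length R1 = length C1" "length R2 = length C2"
  shows "det (minors a (map (Cons x) R1 @ R2) (map (Cons v) C1 @ C2)) =
    a x v ^ length C1 * det (minors a R1 C1) * det (minors a R2 C2)"
proof -
  let ?m = "length R1" and ?n = "length R2"
  have zero: "minor a I (v # J) = 0" if "I \<in> set R2" for I J
  proof (cases "length I = length (v # J)")
    case True
    have "I ! p \<in> set xs" if "p < length I" for p
      using R2[OF \<open>I \<in> set R2\<close>] that by auto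
    moreover from this have "col (mat (length I) (length I) (\<lambda>(p, q). a (I ! p) ((v # J) ! q))) 0 =
        0\<^sub>v (length I)"
      using True a by (intro eq_vecI) auto
    ultimately show ?thesis
      using laplace_expansion_column[of "mat (length I) (length I) (\<lambda>(p, q). a (I ! p) ((v # J) ! q))"
          "length I" 0] True a
      by (simp add: minor_def)
  qed (rule minor_eq_0_if_length_neq)
  have "minors a (map (Cons x) R1 @ R2) (map (Cons v) C1 @ C2) =
    four_block_mat (a x v \<cdot>\<^sub>m minors a R1 C1) (minors a (map (Cons x) R1) C2) (0\<^sub>m ?n ?m)
      (minors a R2 C2)" (is "_ = ?B")
  proof (rule eq_matI)
    fix p q assume "p < dim_row ?B" "q < dim_col ?B"
    then have pq: "p < ?m + ?n" "q < ?m + ?n"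
      using len by (auto simp: minors_def)
    show "minors a (map (Cons x) R1 @ R2) (map (Cons v) C1 @ C2) $$ (p, q) = ?B $$ (p, q)"
    proof (cases "p < ?m")
      case True
      then have "a y v = 0" if "y \<in> set (R1 ! p)" for y
        using that a R1 nth_mem by blast
      then show ?thesis
        using True pq len by (auto simp: minors_def nth_append intro!: minor_Cons_Cons)
    next
      case False
      then show ?thesis
        using pq len zero nth_mem[of "p - ?m" R2] by (auto simp: minors_def nth_append)
    qed
  qed (use len in \<open>auto simp: minors_def\<close>)
  moreover have "dim_col (minors a R1 C1) = length C1"
    by (simp add: minors_def)
  ultimately show ?thesis
    using len by (simp add: det_four_block_mat_lower_left_zero[of _ ?m _ ?n] carrier_matI minors_def)
qed

text \<open>Blocks may have any lengths that are at least \<open>n\<close>, because deleting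
  \<open>v\<close> shortens only the first block. The induction follows the recursion of
  \<open>prefix_choices\<close>.\<close>

theorem det_minors_prefix_choices_field:
  fixes a :: "'r \<Rightarrow> 'c \<Rightarrow> 'a::field"
  assumes "distinct xs" "length fs + n = Suc (length xs)" "\<forall>f\<in>set fs. n \<le> length f"
  shows "det (minors a (ksubseqs n xs) (prefix_choices n fs)) =
    prod_list (map (minor a xs) (full_choices n fs))"
  using assms
proof (induction n fs arbitrary: xs a rule: prefix_choices.induct)
  \<comment> \<open>The 1 by 1 matrix whose entry is the empty minor 1, against an empty
    product.\<close>
  case (1 fs)
  then show ?case
    by (cases fs) (auto simp: minors_def det_single)
next
  \<comment> \<open>Here \<open>length xs = n\<close>, so the matrix has no rows and determinant 1.
    The product is empty, or for \<open>n = 0\<close> consists of the empty minor.\<close>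
  case (2 n)
  then have "ksubseqs (Suc n) xs = []"
    using length_ksubseqs[of "Suc n" xs] by (simp flip: length_0_conv)
  then show ?case
    using 2 by (auto simp: minors_def)
next
  case (3 n fs)
  then show ?case by simp
next
  case (4 n v f fs)
  obtain x ys where xs: "xs = x # ys"
    using 4(4) by (cases xs) auto
  obtain b where b0: "\<And>y. y \<in> set ys \<Longrightarrow> b y v = 0"
    and b: "\<And>n C. length C = length (ksubseqs n xs) \<Longrightarrow>
      det (minors b (ksubseqs n xs) C) = det (minors a (ksubseqs n xs) C)"
    using ex_cleared_column[of "[]" x ys v a] 4(3) xs by auto
  have ys: "distinct ys" "length (f # fs) + n = Suc (length ys)" "length fs + Suc n = Suc (length ys)"
    "\<forall>g\<in>set (f # fs). n \<le> length g" "\<forall>g\<in>set fs. Suc n \<le> length g"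
    using 4(3-5) xs by auto
  let ?p = "b x v" and ?F = "full_choices (Suc n) fs @ full_choices n (f # fs)"
  have len: "length (ksubseqs m zs) = length (prefix_choices m gs)"
    if "length gs + m = Suc (length zs)" "\<forall>g\<in>set gs. m \<le> length g" for m gs and zs :: "'r list"
    using that by (simp add: length_ksubseqs length_prefix_choices)
  \<comment> \<open>The pivot occurs once for every column selection through \<open>v\<close> on the
    left, and once for every factor on the right; the two numbers agree.\<close>
  have lenF: "length ?F = length (prefix_choices n (f # fs))"
    using length_full_choices[of "(v # f) # fs" "Suc n"] length_prefix_choices[of "f # fs" n] 4(5) ys
    by simp
  have full: "length J = length xs" if "J \<in> set (map (Cons v) ?F)" for J
    using that 4(4) full_choices_length_eq[of J "Suc n" "(v # f) # fs"] by simp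
  have sub: "set I \<subseteq> set ys" if "I \<in> set (ksubseqs m ys)" for I m
    using that subseqs_powset[of ys] by (auto simp: set_ksubseqs)
  have "det (minors a (ksubseqs (Suc n) xs) (prefix_choices (Suc n) ((v # f) # fs))) =
      det (minors b (ksubseqs (Suc n) xs) (prefix_choices (Suc n) ((v # f) # fs)))"
    by (rule b[OF len[OF 4(4,5), symmetric], symmetric])
  also have "\<dots> = ?p ^ length ?F * det (minors b (ksubseqs n ys) (prefix_choices n (f # fs))) *
      det (minors b (ksubseqs (Suc n) ys) (prefix_choices (Suc n) fs))"
    unfolding lenF xs ksubseqs_Cons prefix_choices.simps
    by (rule det_minors_block[where xs = ys]) (use b0 sub len[OF ys(2,4)] len[OF ys(3,5)] in \<open>auto simp: set_ksubseqs\<close>)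
  also have "\<dots> = ?p ^ length ?F * prod_list (map (minor b ys) ?F)"
    using 4(1)[OF ys(1,2,4)] 4(2)[OF ys(1,3,5)] by simp
  \<comment> \<open>Every full choice meets the first block, hence begins with \<open>v\<close>, and
    each maximal minor of \<open>b\<close> splits off one pivot.\<close>
  also have "\<dots> = prod_list (map (minor b xs) (map (Cons v) ?F))"
  proof -
    have "prod_list (map (minor b xs) (map (Cons v) L)) = ?p ^ length L * prod_list (map (minor b ys) L)" for L
      unfolding xs by (induction L) (auto simp: minor_Cons_Cons b0)
    then show ?thesis
      by (rule sym)
  qed
  also have "\<dots> = prod_list (map (minor a xs) (map (Cons v) ?F))"
    \<comment> \<open>Invariance is applied to the one-column list \<open>[_]\<close>, where the
      determinant is a maximal minor.\<close>
    using full b[of "[_]" "length xs"]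
    by (intro arg_cong[where f = prod_list] map_cong) (auto simp: minor_eq_det_minors ksubseqs_length_self)
  finally show ?case by simp
qed

subsection \<open>Specialising the generic matrix\<close>

definition monomial_eval :: "(nat \<Rightarrow> 'a::comm_ring_1) \<Rightarrow> (nat \<Rightarrow>\<^sub>0 nat) \<Rightarrow> 'a" where
  "monomial_eval x m = (\<Prod>i\<in>Poly_Mapping.keys m. x i ^ Poly_Mapping.lookup m i)"

text \<open>Evaluation on the ring of integer polynomials in countably many variables; the keys of a
  polynomial are its exponent vectors.\<close>

definition int_poly_eval :: "(nat \<Rightarrow> 'a::comm_ring_1) \<Rightarrow> ((nat \<Rightarrow>\<^sub>0 nat) \<Rightarrow>\<^sub>0 int) \<Rightarrow> 'a" where
  "int_poly_eval x p =
    (\<Sum>m\<in>Poly_Mapping.keys p. of_int (Poly_Mapping.lookup p m) * monomial_eval x m)"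

lemma monomial_eval_0 [simp]: "monomial_eval x 0 = 1"
  by (simp add: monomial_eval_def)

lemma monomial_eval_single [simp]: "monomial_eval x (Poly_Mapping.single i (Suc 0)) = x i"
  by (simp add: monomial_eval_def)

lemma monomial_eval_add: "monomial_eval x (m + m') = monomial_eval x m * monomial_eval x m'"
proof -
  let ?S = "Poly_Mapping.keys m \<union> Poly_Mapping.keys m'"
  have eq: "monomial_eval x k = (\<Prod>i\<in>?S. x i ^ Poly_Mapping.lookup k i)"
    if "Poly_Mapping.keys k \<subseteq> ?S" for k
    unfolding monomial_eval_def by (rule prod.mono_neutral_left) (use that in \<open>auto simp: in_keys_iff\<close>)
  show ?thesis
    using Poly_Mapping.keys_add[of m m']
    by (simp add: eq lookup_add power_add prod.distrib)
qed

lemma int_poly_eval_add: "int_poly_eval x (p + q) = int_poly_eval x p + int_poly_eval x q"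
  unfolding int_poly_eval_def
  by (rule setsum_keys_plus_distrib[where f = "\<lambda>m c. of_int c * monomial_eval x m"])
    (simp_all add: algebra_simps)

lemma int_poly_eval_0 [simp]: "int_poly_eval x 0 = 0"
  by (simp add: int_poly_eval_def)

lemma int_poly_eval_frag_of [simp]: "int_poly_eval x (frag_of m) = monomial_eval x m"
  by (simp add: int_poly_eval_def)

lemma int_poly_eval_diff: "int_poly_eval x (p - q) = int_poly_eval x p - int_poly_eval x q"
  using int_poly_eval_add[of x "p - q" q] by simp

text \<open>Polynomials form the free abelian group on the monomials, so additivity in both
  arguments reduces the claim to products of monomials.\<close>

lemma int_poly_eval_mult: "int_poly_eval x (p * q) = int_poly_eval x p * int_poly_eval x q"
proof (induction p rule: frag_induction[OF subset_UNIV])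
  case (2 m)
  show ?case
  proof (induction q rule: frag_induction[OF subset_UNIV])
    case (2 m')
    show ?case
      by (simp add: mult_single monomial_eval_add)
  qed (simp_all add: int_poly_eval_diff right_diff_distrib)
qed (simp_all add: int_poly_eval_diff left_diff_distrib)

lemma comm_ring_hom_int_poly_eval: "comm_ring_hom (int_poly_eval x)"
  using int_poly_eval_frag_of[of x 0]
  by unfold_locales (simp_all add: int_poly_eval_add int_poly_eval_mult)

lemma comm_ring_hom_Fract: "comm_ring_hom (\<lambda>x :: 'a::idom. Fract x 1)"
  by unfold_locales (simp_all add: Zero_fract_def One_fract_def)

lemma (in comm_ring_hom) hom_minor: "minor (\<lambda>i j. hom (a i j)) I J = hom (minor a I J)"
  unfolding minor_def hom_det[symmetric]
  by (intro arg_cong[where f = det] eq_matI) auto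

lemma (in comm_ring_hom) hom_det_minors:
  "det (minors (\<lambda>i j. hom (a i j)) R C) = hom (det (minors a R C))"
  unfolding minors_def hom_det[symmetric] hom_minor
  by (intro arg_cong[where f = det] eq_matI) auto

lemma (in comm_ring_hom) hom_prod_list_minors:
  "prod_list (map (minor (\<lambda>i j. hom (a i j)) I) Js) = hom (prod_list (map (minor a I) Js))"
  by (induction Js) (simp_all add: hom_minor hom_mult)

theorem det_minors_prefix_choices:
  fixes a :: "nat \<Rightarrow> nat \<Rightarrow> 'a::comm_ring_1"
  assumes "distinct xs" "length fs + n = Suc (length xs)" "\<forall>f\<in>set fs. n \<le> length f"
  shows "det (minors a (ksubseqs n xs) (prefix_choices n fs)) =
    prod_list (map (minor a xs) (full_choices n fs))"
proof -
  \<comment> \<open>The entries of \<open>g\<close> are distinct variables, numbered by the pairing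
    function; \<open>x\<close> sends each of them back to the matching entry of
    \<open>a\<close>.\<close>
  define g :: "nat \<Rightarrow> nat \<Rightarrow> (nat \<Rightarrow>\<^sub>0 nat) \<Rightarrow>\<^sub>0 int"
    where "g i j = frag_of (Poly_Mapping.single (prod_encode (i, j)) 1)" for i j
  define x where "x k = (case prod_decode k of (i, j) \<Rightarrow> a i j)" for k
  interpret F: comm_ring_hom "\<lambda>p :: (nat \<Rightarrow>\<^sub>0 nat) \<Rightarrow>\<^sub>0 int. Fract p 1"
    by (rule comm_ring_hom_Fract)
  interpret E: comm_ring_hom "int_poly_eval x"
    by (rule comm_ring_hom_int_poly_eval)
  \<comment> \<open>The embedding into the fraction field is injective, so the field identity
    descends to polynomials.\<close>
  have "det (minors g (ksubseqs n xs) (prefix_choices n fs)) =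
      prod_list (map (minor g xs) (full_choices n fs))"
    using det_minors_prefix_choices_field[OF assms, of "\<lambda>i j. Fract (g i j) 1"]
    by (simp add: F.hom_det_minors F.hom_prod_list_minors eq_fract)
  moreover have "a = (\<lambda>i j. int_poly_eval x (g i j))"
    by (intro ext) (simp add: g_def x_def)
  ultimately show ?thesis
    by (simp add: E.hom_det_minors E.hom_prod_list_minors)
qed

subsection \<open>Lexicographic enumeration of the index sets\<close>

text \<open>Exactly \<open>k\<close> elements of the set lie below \<open>I ! k\<close>, and
  \<open>pick\<close> is determined by that count.\<close>

lemma pick_set_sorted:
  assumes "sorted_wrt (<) I" "k < length I"
  shows "pick (set I) k = I ! k"
proof -
  have "{i \<in> set I. i < I ! k} = (!) I ` {..<k}"
  proof (intro equalityI subsetI)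
    fix i assume "i \<in> {i \<in> set I. i < I ! k}"
    then obtain l where l: "l < length I" "i = I ! l" "I ! l < I ! k"
      by (auto simp: in_set_conv_nth)
    then have "l < k"
      using sorted_wrt_nth_less[OF assms(1), of k l] by (cases l k rule: linorder_cases) auto
    then show "i \<in> (!) I ` {..<k}"
      using l by simp
  qed (use assms sorted_wrt_nth_less[OF assms(1)] in auto)
  moreover have "inj_on ((!) I) {..<k}"
    using assms by (auto simp: inj_on_def nth_eq_iff_index_eq strict_sorted_iff)
  ultimately have "card {i \<in> set I. i < I ! k} = k"
    by (simp add: card_image)
  then show ?thesis
    using pick_card_in_set[of "I ! k" "set I"] assms(2) by simp
qed

lemma card_set_sorted: "sorted_wrt (<) (I :: nat list) \<Longrightarrow> card (set I) = length I"
  by (simp add: distinct_card strict_sorted_iff)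

lemma lex_less_set_iff:
  assumes "sorted_wrt (<) I" "sorted_wrt (<) J" "length I = length J"
  shows "lex_less (set I) (set J) \<longleftrightarrow>
    (\<exists>k<length J. (\<forall>l<k. I ! l = J ! l) \<and> I ! k < J ! k)"
  using assms unfolding lex_less_def
  by (auto simp: card_set_sorted pick_set_sorted intro!: ex_cong)

lemma lex_less_Cons_less:
  assumes "sorted_wrt (<) (x # I)" "sorted_wrt (<) (y # J)" "length I = length J" "x < y"
  shows "lex_less (set (x # I)) (set (y # J))"
  by (subst lex_less_set_iff) (use assms in \<open>auto intro: exI[of _ 0]\<close>)

lemma lex_less_Cons_same:
  assumes "sorted_wrt (<) (x # I)" "sorted_wrt (<) (x # J)" "length I = length J"
    "lex_less (set I) (set J)"
  shows "lex_less (set (x # I)) (set (x # J))"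
proof -
  obtain k where "k < length J" "\<forall>l<k. I ! l = J ! l" "I ! k < J ! k"
    using assms lex_less_set_iff[of I J] by auto
  then have "Suc k < length (x # J)" "\<forall>l<Suc k. (x # I) ! l = (x # J) ! l"
    "(x # I) ! Suc k < (x # J) ! Suc k"
    by (auto simp: less_Suc_eq_0_disj)
  then show ?thesis
    by (subst lex_less_set_iff) (use assms in auto)
qed

text \<open>Common shape of the recursions of \<open>ksubseqs\<close> and
  \<open>prefix_choices\<close>: the selections through the least index precede all the
  others.\<close>

lemma sorted_lex_append:
  assumes A: "sorted_wrt lex_less (map set A)" and B: "sorted_wrt lex_less (map set B)"
    and IA: "\<And>I. I \<in> set A \<Longrightarrow> sorted_wrt (<) (x # I) \<and> length I = n"
    and IB: "\<And>J. J \<in> set B \<Longrightarrow> sorted_wrt (<) J \<and> length J = Suc n \<and> (\<forall>y\<in>set J. x < y)"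
  shows "sorted_wrt lex_less (map set (map (Cons x) A @ B))"
proof -
  have "sorted_wrt lex_less (map set (map (Cons x) A))"
    using A unfolding sorted_wrt_map
    by (rule sorted_wrt_mono_rel[rotated]) (use IA in \<open>blast intro: lex_less_Cons_same\<close>)
  moreover have "lex_less (set (x # I)) (set J)" if "I \<in> set A" "J \<in> set B" for I J
    using IA[OF that(1)] IB[OF that(2)] by (cases J) (auto intro!: lex_less_Cons_less[simplified])
  ultimately show ?thesis
    using B by (auto simp: sorted_wrt_append)
qed

lemma sorted_wrt_subseq: "subseq ys xs \<Longrightarrow> sorted_wrt P xs \<Longrightarrow> sorted_wrt P ys"
  by (induction rule: list_emb.induct) (auto dest: list_emb_set)

lemma subseq_set: "subseq ys xs \<Longrightarrow> x \<in> set ys \<Longrightarrow> x \<in> set xs"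
  using subseqs_powset[of xs] by auto

lemma sorted_lex_ksubseqs:
  "sorted_wrt (<) xs \<Longrightarrow> sorted_wrt lex_less (map set (ksubseqs n xs))"
proof (induction xs arbitrary: n)
  case Nil
  then show ?case by (cases n) (simp_all add: ksubseqs_Nil)
next
  case (Cons x xs)
  show ?case
  proof (cases n)
    case (Suc m)
    have "sorted_wrt (<) I \<and> set I \<subseteq> set xs" if "subseq I xs" for I
      using that Cons.prems subseq_set[OF that] by (auto intro: sorted_wrt_subseq)
    then show ?thesis
      using Cons unfolding Suc ksubseqs_Cons
      by (intro sorted_lex_append[where n = m]) (auto simp: set_ksubseqs)
  qed simp
qed

lemma subseq_prefix_choices:
  "J \<in> set (prefix_choices n fs) \<Longrightarrow> subseq J (concat fs) \<and> length J = n"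
  by (induction n fs arbitrary: J rule: prefix_choices.induct) (auto intro: list_emb_append2)

lemma subseq_full_choices: "J \<in> set (full_choices n fs) \<Longrightarrow> subseq J (concat fs)"
  by (induction n fs arbitrary: J rule: full_choices.induct)
    (auto split: if_splits intro: list_emb_append2)

lemma sorted_lex_prefix_choices:
  "sorted_wrt (<) (concat fs) \<Longrightarrow> sorted_wrt lex_less (map set (prefix_choices n fs))"
proof (induction n fs rule: prefix_choices.induct)
  case (4 n v f fs)
  have 1: "sorted_wrt (<) I \<and> set I \<subseteq> set (f @ concat fs) \<and> length I = n"
    if "I \<in> set (prefix_choices n (f # fs))" for I
    using subseq_prefix_choices[OF that] 4(3) subseq_set[of I "f @ concat fs"]
    by (auto intro: sorted_wrt_subseq)
  have 2: "sorted_wrt (<) I \<and> set I \<subseteq> set (concat fs) \<and> length I = Suc n"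
    if "I \<in> set (prefix_choices (Suc n) fs)" for I
    using subseq_prefix_choices[OF that] 4(3) subseq_set[of I "concat fs"]
    by (auto simp: sorted_wrt_append intro: sorted_wrt_subseq)
  show ?case
    unfolding prefix_choices.simps
  proof (rule sorted_lex_append[where n = n])
    show "sorted_wrt lex_less (map set (prefix_choices (Suc n) fs))"
      using 4(2,3) by (simp add: sorted_wrt_append)
  qed (use 4 1 2 in \<open>fastforce simp: sorted_wrt_append\<close>)+
qed simp_all

text \<open>Allows the list product to be read as a product over a set.\<close>

lemma distinct_full_choices:
  "distinct (concat fs) \<Longrightarrow> distinct (full_choices n fs)"
proof (induction n fs rule: full_choices.induct)
  case (4 n v f fs)
  have "J \<notin> set (full_choices n (f # fs))" if J: "J \<in> set (full_choices (Suc n) fs)" for J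
  proof
    assume J': "J \<in> set (full_choices n (f # fs))"
    \<comment> \<open>A choice from \<open>f # fs\<close> takes at least the first element
      \<open>w\<close> of \<open>f\<close>, while a choice from \<open>fs\<close> avoids
      \<open>f\<close>.\<close>
    then obtain m w f' where "n = Suc m" "f = w # f'"
      by (cases "(n, f # fs)" rule: full_choices.cases) auto
    then have "w \<in> set J" "w \<in> set f"
      using J' by auto
    then show False
      using subseq_set[OF subseq_full_choices[OF J]] 4(3) by auto
  qed
  then show ?case
    using 4 by (auto simp: distinct_map)
qed auto

section \<open>Recursions for the sequences of segment lengths\<close>

lemma Zs_Cons: "k # \<mu> \<in> Zs s m \<longleftrightarrow> (\<exists>s'. s = Suc s' \<and> k \<le> m \<and> \<mu> \<in> Zs s' (m - k))"
  by (cases s) (auto simp: Zs_def)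

lemma Zs0_Cons:
  "k # \<mu> \<in> Zs0 s m \<longleftrightarrow> (\<exists>s'. s = Suc s' \<and> 0 < k \<and> k \<le> m \<and> \<mu> \<in> Zs0 s' (m - k))"
  by (cases s) (auto simp: Zs0_def All_less_Suc2)

lemma Cons_in_Suc_hd_image:
  assumes "[] \<notin> X"
  shows "k # \<nu> \<in> (\<lambda>\<mu>. Suc (hd \<mu>) # tl \<mu>) ` X \<longleftrightarrow> (\<exists>l. k = Suc l \<and> l # \<nu> \<in> X)"
proof
  assume "k # \<nu> \<in> (\<lambda>\<mu>. Suc (hd \<mu>) # tl \<mu>) ` X"
  then obtain \<mu> where "\<mu> \<in> X" "k = Suc (hd \<mu>)" "\<nu> = tl \<mu>" by auto
  moreover from this have "\<mu> = hd \<mu> # tl \<mu>"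
    using assms by (metis list.collapse)
  ultimately show "\<exists>l. k = Suc l \<and> l # \<nu> \<in> X" by metis
next
  assume "\<exists>l. k = Suc l \<and> l # \<nu> \<in> X"
  then show "k # \<nu> \<in> (\<lambda>\<mu>. Suc (hd \<mu>) # tl \<mu>) ` X"
    by (auto intro!: image_eqI[where x = "_ # \<nu>"])
qed

lemma Cons_in_Cons_image: "k # \<nu> \<in> Cons c ` X \<longleftrightarrow> k = c \<and> \<nu> \<in> X"
  by auto

text \<open>Case distinction on whether the first part is positive, parallel to the last equation of
  \<open>prefix_choices\<close>.\<close>

lemma Zs_Suc_Suc:
  "Zs (Suc s) (Suc n) = (\<lambda>\<mu>. Suc (hd \<mu>) # tl \<mu>) ` Zs (Suc s) n \<union> Cons 0 ` Zs s (Suc n)"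
proof (rule Set.set_eqI)
  fix \<mu>
  have ne: "[] \<notin> Zs (Suc s) n" by (simp add: Zs_def)
  show "\<mu> \<in> Zs (Suc s) (Suc n) \<longleftrightarrow>
      \<mu> \<in> (\<lambda>\<mu>. Suc (hd \<mu>) # tl \<mu>) ` Zs (Suc s) n \<union> Cons 0 ` Zs s (Suc n)"
  proof (cases \<mu>)
    case (Cons k \<nu>)
    then show ?thesis
      by (cases k) (simp_all add: Cons_in_Suc_hd_image[OF ne] Cons_in_Cons_image Zs_Cons)
  qed (auto simp: Zs_def)
qed

text \<open>The first part is 1 or at least 2, parallel to the last equation of
  \<open>full_choices\<close>.\<close>

lemma Zs0_Suc_Suc:
  "Zs0 (Suc s) (Suc m) = Cons 1 ` Zs0 s m \<union> (\<lambda>\<mu>. Suc (hd \<mu>) # tl \<mu>) ` Zs0 (Suc s) m"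
proof (rule Set.set_eqI)
  fix \<mu>
  have ne: "[] \<notin> Zs0 (Suc s) m" by (simp add: Zs0_def)
  show "\<mu> \<in> Zs0 (Suc s) (Suc m) \<longleftrightarrow>
      \<mu> \<in> Cons 1 ` Zs0 s m \<union> (\<lambda>\<mu>. Suc (hd \<mu>) # tl \<mu>) ` Zs0 (Suc s) m"
  proof (cases \<mu>)
    case (Cons k \<nu>)
    consider "k = 0" | "k = 1" | l where "k = Suc (Suc l)"
      by (metis One_nat_def not0_implies_Suc)
    then show ?thesis
      by cases (simp_all add: Cons Cons_in_Suc_hd_image[OF ne] Cons_in_Cons_image Zs0_Cons)
  qed (auto simp: Zs0_def)
qed
lemma map2_take_Suc_hd:
  "\<mu> \<noteq> [] \<Longrightarrow> concat (map2 take (Suc (hd \<mu>) # tl \<mu>) ((v # f) # fs)) = v # concat (map2 take \<mu> (f # fs))"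
  by (cases \<mu>) auto

lemma map2_take_0: "concat (map2 take (0 # \<mu>) (f # fs)) = concat (map2 take \<mu> fs)"
  by simp

lemma map2_take_1: "concat (map2 take (Suc 0 # \<mu>) ((v # f) # fs)) = v # concat (map2 take \<mu> fs)"
  by simp

text \<open>The parts of \<open>\<mu>\<close> are the lengths of the initial segments; the bound on
  the blocks ensures that \<open>take\<close> finds enough elements.\<close>

lemma set_prefix_choices:
  "\<forall>f\<in>set fs. n \<le> length f \<Longrightarrow>
    set (prefix_choices n fs) = (\<lambda>\<mu>. concat (map2 take \<mu> fs)) ` Zs (length fs) n"
proof (induction n fs rule: prefix_choices.induct)
  case (1 fs)
  have "\<mu> = replicate (length fs) 0 \<longleftrightarrow> \<mu> \<in> Zs (length fs) 0" for \<mu>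
    by (auto simp: Zs_def intro: replicate_eqI)
  then have "Zs (length fs) 0 = {replicate (length fs) 0}"
    by blast
  moreover have "concat (map2 take (replicate (length fs) 0) fs) = []"
    by (induction fs) auto
  ultimately show ?case by simp
next
  case (4 n v f fs)
  have "\<mu> \<noteq> []" if "\<mu> \<in> Zs (Suc (length fs)) n" for \<mu>
    using that by (auto simp: Zs_def)
  moreover have "\<forall>g\<in>set (f # fs). n \<le> length g" "\<forall>g\<in>set fs. Suc n \<le> length g"
    using 4(3) by (auto intro: Suc_leD)
  ultimately show ?case
    using 4(1,2)
    by (simp add: Zs_Suc_Suc image_Un image_image map2_take_Suc_hd map2_take_0 del: zip_Cons_Cons cong: image_cong)
qed (auto simp: Zs_def)

lemma set_full_choices:
  "\<forall>f\<in>set fs. n \<le> length f \<Longrightarrow> Suc m = length fs + n \<Longrightarrow>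
    set (full_choices n fs) = (\<lambda>\<mu>. concat (map2 take \<mu> fs)) ` Zs0 (length fs) m"
proof (induction n fs arbitrary: m rule: full_choices.induct)
  \<comment> \<open>Now \<open>m\<close> is one less than the number of parts, so the parts cannot
    all be positive.\<close>
  case (2 f fs)
  have le: "length \<mu> \<le> sum_list \<mu>" if "\<forall>i<length \<mu>. 0 < \<mu> ! i" for \<mu> :: "nat list"
    using that by (induction \<mu>) (auto simp: All_less_Suc2)
  have "\<mu> \<notin> Zs0 (length (f # fs)) m" for \<mu>
    using le[of \<mu>] 2 by (auto simp: Zs0_def)
  then have "Zs0 (length (f # fs)) m = {}"
    by blast
  then show ?case by simp
next
  case (4 n v f fs)
  obtain k where k: "m = Suc k" "Suc k = length fs + Suc n" "Suc k = length (f # fs) + n"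
    using 4(4) by (cases m) auto
  have "\<mu> \<noteq> []" if "\<mu> \<in> Zs0 (Suc (length fs)) k" for \<mu>
    using that by (auto simp: Zs0_def)
  moreover have "\<forall>g\<in>set (f # fs). n \<le> length g" "\<forall>g\<in>set fs. Suc n \<le> length g"
    using 4(3) by (auto intro: Suc_leD)
  ultimately show ?case
    using 4(1)[OF _ k(2)] 4(2)[OF _ k(3)]
    by (simp add: k(1) Zs0_Suc_Suc image_Un image_image map2_take_Suc_hd map2_take_1 del: zip_Cons_Cons cong: image_cong)
qed (auto simp: Zs0_def)

section \<open>Column blocks and the enumeration of the index families\<close>

definition blocks :: "nat \<Rightarrow> nat \<Rightarrow> nat list list" where
  "blocks s n = map (\<lambda>i. [i * n ..< i * n + n]) [0..<s]"

lemma concat_blocks: "concat (blocks s n) = [0..<s * n]"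
proof (induction s)
  case (Suc s)
  have "concat (blocks (Suc s) n) = [0..<s * n] @ [s * n..<s * n + n]"
    using Suc by (simp add: blocks_def)
  then show ?case
    using upt_add_eq_append[of 0 "s * n" n] by (simp add: add.commute)
qed (simp add: blocks_def)

lemma set_concat_take_blocks:
  assumes "length \<mu> = s" "\<And>i. i < s \<Longrightarrow> \<mu> ! i \<le> n"
  shows "set (concat (map2 take \<mu> (blocks s n))) = iota s n \<mu>"
proof -
  have "map2 take \<mu> (blocks s n) = map (\<lambda>i. [i * n ..< i * n + \<mu> ! i]) [0..<s]"
    by (rule nth_equalityI) (use assms in \<open>auto simp: blocks_def\<close>)
  then show ?thesis
    by (auto simp: iota_def)
qed

lemma Zs_nth_le: "\<mu> \<in> Zs s m \<Longrightarrow> i < s \<Longrightarrow> \<mu> ! i \<le> m"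
  using elem_le_sum_list[of i \<mu>] by (auto simp: Zs_def)

text \<open>The other \<open>s - 1\<close> parts are at least 1 each, which leaves at most
  \<open>n\<close>.\<close>

lemma Zs0_nth_le:
  assumes "\<mu> \<in> Zs0 s (s + n - 1)" "i < s"
  shows "\<mu> ! i \<le> n"
proof -
  have "(\<Sum>j<s. \<mu> ! j) = \<mu> ! i + (\<Sum>j\<in>{..<s} - {i}. \<mu> ! j)"
    using assms by (simp add: sum.remove)
  moreover have "(\<Sum>j\<in>{..<s} - {i}. 1) \<le> (\<Sum>j\<in>{..<s} - {i}. \<mu> ! j)"
    using assms by (intro sum_mono) (auto simp: Zs0_def Suc_le_eq)
  moreover have "(\<Sum>j<s. \<mu> ! j) = s + n - 1"
    using assms by (auto simp: Zs0_def sum_list_sum_nth atLeast0LessThan)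
  ultimately show ?thesis
    using assms(2) by simp
qed

lemma lex_list_eqI:
  assumes "sorted_wrt lex_less xs" "set xs = F" "finite F" "\<And>I. I \<in> F \<Longrightarrow> finite I \<and> card I = r"
  shows "lex_list F = xs"
  unfolding lex_list_def
  by (rule the1_equality[OF lex_list_ex1[where r = r]]) (use assms in auto)

lemma set_image_ksubseqs:
  fixes xs :: "nat list"
  assumes "sorted_wrt (<) xs"
  shows "set ` set (ksubseqs n xs) = {X. X \<subseteq> set xs \<and> card X = n}"
proof (rule Set.set_eqI)
  fix X
  have card: "card (set I) = length I" if "subseq I xs" for I
    using assms by (intro card_set_sorted sorted_wrt_subseq[OF that])
  have "X \<in> {X. X \<subseteq> set xs \<and> card X = n} \<longleftrightarrow> X \<in> set ` {I. subseq I xs} \<and> card X = n"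
    using subseqs_powset[of xs] by (simp add: set_subseqs_eq)
  also have "\<dots> \<longleftrightarrow> X \<in> set ` set (ksubseqs n xs)"
    unfolding set_ksubseqs image_iff bex_simps mem_Collect_eq using card by metis
  finally show "X \<in> set ` set (ksubseqs n xs) \<longleftrightarrow> X \<in> {X. X \<subseteq> set xs \<and> card X = n}" ..
qed

lemma lex_list_row_sets_eq: "lex_list (row_sets s n) = map set (ksubseqs n [0..<s + n - 1])"
proof (rule lex_list_eqI[where r = n])
  show "set (map set (ksubseqs n [0..<s + n - 1])) = row_sets s n"
    by (simp only: set_map set_image_ksubseqs[OF sorted_wrt_upt] set_upt row_sets_def)
  show "sorted_wrt lex_less (map set (ksubseqs n [0..<s + n - 1]))"
    by (rule sorted_lex_ksubseqs) (rule sorted_wrt_upt)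
  show "finite (row_sets s n)"
    using lex_list_row_sets(2)[of s n] by (metis List.finite_set)
  show "finite I \<and> card I = n" if "I \<in> row_sets s n" for I
    using that finite_subset[of I "{0..<s + n - 1}"] by (simp add: row_sets_def)
qed

lemma lex_list_col_sets_eq: "lex_list (col_sets s n) = map set (prefix_choices n (blocks s n))"
proof (rule lex_list_eqI[where r = n])
  let ?f = "\<lambda>\<mu>. concat (map2 take \<mu> (blocks s n))"
  have len: "\<forall>f\<in>set (blocks s n). n \<le> length f" "length (blocks s n) = s"
    by (auto simp: blocks_def)
  have "set (map set (prefix_choices n (blocks s n))) = (\<lambda>\<mu>. set (?f \<mu>)) ` Zs s n"
    by (simp add: set_prefix_choices[OF len(1)] len(2) image_image)
  also have "\<dots> = col_sets s n"
    unfolding col_sets_def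
    by (intro image_cong refl set_concat_take_blocks) (auto simp: Zs_def intro: Zs_nth_le)
  finally show eq: "set (map set (prefix_choices n (blocks s n))) = col_sets s n" .
  then show "finite (col_sets s n)"
    by (metis List.finite_set)
  show "sorted_wrt lex_less (map set (prefix_choices n (blocks s n)))"
    by (rule sorted_lex_prefix_choices) (simp add: concat_blocks)
  show "finite J \<and> card J = n" if J: "J \<in> col_sets s n" for J
  proof -
    obtain L where L: "J = set L" "L \<in> set (prefix_choices n (blocks s n))"
      using J unfolding eq[symmetric] by auto
    then have "subseq L [0..<s * n]" "length L = n"
      using subseq_prefix_choices[OF L(2)] by (simp_all only: concat_blocks)
    then show ?thesis
      using card_set_sorted[OF sorted_wrt_subseq[OF _ sorted_wrt_upt]] L(1) by simp
  qed
qed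

text \<open>Full choices are strictly increasing lists, on which \<open>set\<close> is injective,
  and their enumeration has no repetitions.\<close>

lemma prod_col_sets0:
  assumes "n > 0" "s > 0"
  shows "(\<Prod>J\<in>col_sets0 s n. F J) = (\<Prod>J\<leftarrow>full_choices n (blocks s n). F (set J))"
proof -
  let ?L = "full_choices n (blocks s n)" and ?f = "\<lambda>\<mu>. concat (map2 take \<mu> (blocks s n))"
  have len: "\<forall>f\<in>set (blocks s n). n \<le> length f" "length (blocks s n) = s"
    by (auto simp: blocks_def)
  have "set ` set ?L = (\<lambda>\<mu>. set (?f \<mu>)) ` Zs0 s (s + n - 1)"
    using set_full_choices[OF len(1), of "s + n - 1"] assms len(2) by (simp add: image_image)
  also have "\<dots> = col_sets0 s n"
    unfolding col_sets0_def
    by (intro image_cong refl set_concat_take_blocks) (auto simp: Zs0_def intro: Zs0_nth_le)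
  finally have eq: "col_sets0 s n = set ` set ?L" ..
  have sorted: "sorted_wrt (<) J" if "J \<in> set ?L" for J
    using sorted_wrt_subseq[OF subseq_full_choices[OF that], of "(<)"] by (simp add: concat_blocks)
  have "inj_on set (set ?L)"
    using sorted by (auto simp: inj_on_def intro: strict_sorted_equal)
  then have "(\<Prod>J\<in>col_sets0 s n. F J) = (\<Prod>J\<in>set ?L. F (set J))"
    unfolding eq by (simp add: prod.reindex)
  also have "\<dots> = (\<Prod>J\<leftarrow>?L. F (set J))"
    by (rule prod.distinct_set_conv_list) (simp add: distinct_full_choices concat_blocks)
  finally show ?thesis .
qed

section \<open>Determinants of submatrices as minors\<close>

lemma card_less_in_set:
  fixes I :: "nat list"
  assumes "sorted_wrt (<) I" "set I \<subseteq> {..<m}"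
  shows "card {i. i < m \<and> i \<in> set I} = length I"
proof -
  have "{i. i < m \<and> i \<in> set I} = set I"
    using assms(2) by auto
  then show ?thesis
    by (simp only: card_set_sorted[OF assms(1)])
qed

text \<open>\<open>submatrix\<close> counts only indices within the dimensions of \<open>A\<close>;
  the inclusions guarantee that these are all entries of \<open>I\<close> and
  \<open>J\<close>.\<close>

lemma det_submatrix_eq_minor:
  assumes "A \<in> carrier_mat m k" "sorted_wrt (<) I" "set I \<subseteq> {..<m}"
    "sorted_wrt (<) J" "set J \<subseteq> {..<k}"
  shows "det (submatrix A (set I) (set J)) = minor (\<lambda>i j. A $$ (i, j)) I J"
proof -
  have 1: "card {i. i < dim_row A \<and> i \<in> set I} = length I" "card {i. i < dim_col A \<and> i \<in> set J} = length J"
    using assms(1) card_less_in_set[OF assms(2,3)] card_less_in_set[OF assms(4,5)] by simp_all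
  have "submatrix A (set I) (set J) = mat (length I) (length J) (\<lambda>(p, q). A $$ (I ! p, J ! q))"
    unfolding submatrix_def 1
    by (rule cong_mat)
      (simp_all only: prod.case pick_set_sorted[OF assms(2)] pick_set_sorted[OF assms(4)])
  then show ?thesis
    by (simp only: minor_def)
qed

lemma det_submatrix_UNIV_eq_minor:
  assumes "A \<in> carrier_mat m k" "sorted_wrt (<) J" "set J \<subseteq> {..<k}"
  shows "det (submatrix A UNIV (set J)) = minor (\<lambda>i j. A $$ (i, j)) [0..<m] J"
proof -
  have 1: "card {i. i < dim_row A \<and> i \<in> UNIV} = m" "card {i. i < dim_col A \<and> i \<in> set J} = length J"
    using assms(1) card_less_in_set[OF assms(2,3)] by simp_all
  have "submatrix A UNIV (set J) = mat m (length J) (\<lambda>(p, q). A $$ ([0..<m] ! p, J ! q))"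
    unfolding submatrix_def 1
    by (rule cong_mat) (simp_all add: pick_UNIV pick_set_sorted[OF assms(2)])
  then show ?thesis
    by (simp only: minor_def length_upt diff_zero)
qed

theorem theorem1p3:
  fixes A :: "'a::comm_ring_1 mat" and s n :: nat
  assumes "s > 0" and "n > 0"
    and "A \<in> carrier_mat (s + n - 1) (s * n)"
  shows "det (minor_mat A (row_sets s n) (col_sets s n)) =
    (\<Prod>J \<in> col_sets0 s n. det (submatrix A UNIV J))"
proof -
  define a where "a = (\<lambda>i j. A $$ (i, j))"
  let ?xs = "[0..<s + n - 1]" and ?fs = "blocks s n"
  have sub: "sorted_wrt (<) L \<and> set L \<subseteq> {..<N}" if "subseq L [0..<N]" for L N
    using sorted_wrt_subseq[OF that sorted_wrt_upt] subseq_set[OF that] by auto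
  have rows: "sorted_wrt (<) I \<and> set I \<subseteq> {..<s + n - 1}" if "I \<in> set (ksubseqs n ?xs)" for I
    using that sub[of I "s + n - 1"] by (simp add: set_ksubseqs)
  have cols: "sorted_wrt (<) J \<and> set J \<subseteq> {..<s * n}" if "J \<in> set (prefix_choices n ?fs)" for J
    using subseq_prefix_choices[OF that] sub[of J "s * n"] by (simp add: concat_blocks)
  have full: "sorted_wrt (<) J \<and> set J \<subseteq> {..<s * n}" if "J \<in> set (full_choices n ?fs)" for J
    using subseq_full_choices[OF that] sub[of J "s * n"] by (simp add: concat_blocks)
  have "minor_mat A (row_sets s n) (col_sets s n) = minors a (ksubseqs n ?xs) (prefix_choices n ?fs)"
    unfolding minor_mat_def minors_def lex_list_row_sets_eq lex_list_col_sets_eq length_map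
  proof (rule cong_mat[OF refl refl])
    fix p q assume pq: "p < length (ksubseqs n ?xs)" "q < length (prefix_choices n ?fs)"
    show "(case (p, q) of (p, q) \<Rightarrow> det (submatrix A (map set (ksubseqs n ?xs) ! p)
        (map set (prefix_choices n ?fs) ! q))) =
      (case (p, q) of (p, q) \<Rightarrow> minor a (ksubseqs n ?xs ! p) (prefix_choices n ?fs ! q))"
      using pq rows[OF nth_mem[OF pq(1)]] cols[OF nth_mem[OF pq(2)]]
      by (simp add: det_submatrix_eq_minor[OF assms(3)] a_def)
  qed
  \<comment> \<open>Positivity makes the subtraction in \<open>s + n - 1\<close> exact, so that
    \<open>length ?fs + n = Suc (length ?xs)\<close>.\<close>
  also have "det \<dots> = (\<Prod>J\<leftarrow>full_choices n ?fs. minor a ?xs J)"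
    by (rule det_minors_prefix_choices) (use assms(1,2) in \<open>auto simp: blocks_def\<close>)
  also have "\<dots> = (\<Prod>J\<leftarrow>full_choices n ?fs. det (submatrix A UNIV (set J)))"
    using full by (intro arg_cong[where f = prod_list] map_cong)
      (auto simp: det_submatrix_UNIV_eq_minor[OF assms(3)] a_def)
  also have "\<dots> = (\<Prod>J\<in>col_sets0 s n. det (submatrix A UNIV J))"
    using assms(1,2) by (simp add: prod_col_sets0)
  finally show ?thesis .
qed

end
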